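(* Let $n\ge2$. For every tree $T$ on $n$ vertices, $\mathscr{K}(T)\le\mathscr{K}(P_n)$, where $P_n$ is the path on $n$ vertices; that is, among all trees on $n$ vertices the path maximizes Kemeny's constant.
   Context: For a connected graph $H$ with $m\ge1$ edges and degrees $d_i$, Kemeny's constant is $\mathscr{K}(H)=\sum_j\pi_jm_{ij}$ for the simple random walk on $H$, where $\pi_j=d_j/2m$ and $m_{ij}$ is the expected hitting time of $j$ from $i$ ($m_{jj}=0$); equivalently $\mathscr{K}(H)=\frac1{4m}\sum_{i,j}d_id_jr_H(i,j)$, where $r_H$ is effective resistance (for a tree, $r_H(i,j)$ is the graph distance). *)

theory Defs
  imports "HOL-Probability.Probability" "Graph_Theory.Graph_Theory"
begin

text \<open>
  A finite simple graph is a \<^locale>\<open>pair_graph\<close>: a finite, symmetric, loop-free set of arcs,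
  with each undirected edge \<open>uv\<close> represented by the two arcs \<open>(u, v)\<close> and \<open>(v, u)\<close>.
\<close>

definition edge_set :: "'a pair_pre_digraph \<Rightarrow> 'a set set" where
  "edge_set G = (\<lambda>(u, v). {u, v}) ` parcs G"

definition vertex_degree :: "'a pair_pre_digraph \<Rightarrow> 'a \<Rightarrow> nat" where
  "vertex_degree G v = out_degree (with_proj G) v"

text \<open>
  The predicate \<open>tree\<close> of the graph library forbids all directed cycles, including \<open>u \<rightarrow> v \<rightarrow> u\<close>,
  so it fails for every symmetric graph with an edge.  In a symmetric loop-free graph
  the cycles of the underlying undirected graph are the directed ones of length at least 3.
\<close>

definition undirected_tree :: "'a pair_pre_digraph \<Rightarrow> bool" where
  "undirected_tree G \<longleftrightarrow> pair_graph G \<and> Digraph_Component.connected (with_proj G) \<and>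
     \<not> (\<exists>p. pre_digraph.cycle (with_proj G) p \<and> 3 \<le> length p)"

definition path_graph :: "nat \<Rightarrow> nat pair_pre_digraph" where
  "path_graph n = \<lparr> pverts = {0..<n},
     parcs = {(u, v). u < n \<and> v < n \<and> (v = Suc u \<or> u = Suc v)} \<rparr>"


text \<open>
  The simple random walk from \<open>i\<close>, given by the law of its \<open>t\<close>-th position conditioned on the
  positions at times \<open>0, \<dots>, t - 1\<close>.
\<close>

fun walk_kernel :: "'a pair_pre_digraph \<Rightarrow> 'a \<Rightarrow> nat \<Rightarrow> (nat \<Rightarrow> 'a) \<Rightarrow> 'a measure" where
  "walk_kernel G i 0 \<omega> = measure_pmf (return_pmf i)"
| "walk_kernel G i (Suc t) \<omega> = measure_pmf (pmf_of_set {w. (\<omega> t, w) \<in> parcs G})"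

interpretation walk: Ionescu_Tulcea "walk_kernel G i" "\<lambda>_. count_space UNIV"
  for G :: "'a pair_pre_digraph" and i :: 'a
proof (rule Ionescu_Tulcea.intro)
  fix t
  show "walk_kernel G i t \<in> measurable (PiM {0..<t} (\<lambda>_. count_space UNIV))
      (subprob_algebra (count_space UNIV))"
  proof (cases t)
    case 0
    have "walk_kernel G i 0 = (\<lambda>_. measure_pmf (return_pmf i))"
      by (simp add: fun_eq_iff)
    then show ?thesis
      using 0 by (simp add: measure_pmf_in_subprob_algebra)
  next
    case (Suc s)
    have eq: "walk_kernel G i (Suc s) =
        (\<lambda>v. measure_pmf (pmf_of_set {w. (v, w) \<in> parcs G})) \<circ> (\<lambda>\<omega>. \<omega> s)"
      by (simp add: fun_eq_iff)
    show ?thesis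
      unfolding Suc eq
      by (rule measurable_comp[where N = "count_space UNIV"])
        (auto intro!: measurable_component_singleton simp: measure_pmf_in_subprob_algebra)
  qed
next
  show "prob_space (walk_kernel G i t \<omega>)" for t :: nat and \<omega> :: "nat \<Rightarrow> 'a"
    by (cases t) (auto intro: prob_space_measure_pmf)
qed

text \<open>The law of the walk on the space of its trajectories \<open>\<omega> :: nat \<Rightarrow> 'a\<close>.\<close>

definition walk_measure :: "'a pair_pre_digraph \<Rightarrow> 'a \<Rightarrow> (nat \<Rightarrow> 'a) measure" where
  "walk_measure G i = walk.PF.lim G i"

text \<open>Time 0 is included, so the hitting time of the starting vertex is 0;
  if \<open>j\<close> is never visited, the infimum of the empty set is \<open>\<infinity>\<close>.\<close>

definition hitting_time :: "'a \<Rightarrow> (nat \<Rightarrow> 'a) \<Rightarrow> enat" where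
  "hitting_time j \<omega> = (INF t \<in> {t. \<omega> t = j}. enat t)"

definition expected_hitting_time :: "'a pair_pre_digraph \<Rightarrow> 'a \<Rightarrow> 'a \<Rightarrow> ennreal" where
  "expected_hitting_time G i j =
     (\<integral>\<^sup>+\<omega>. ennreal_of_enat (hitting_time j \<omega>) \<partial>walk_measure G i)"

definition stationary :: "'a pair_pre_digraph \<Rightarrow> 'a \<Rightarrow> real" where
  "stationary G j = real (vertex_degree G j) / (2 * real (card (edge_set G)))"

text \<open>
  The starting vertex \<open>i\<close> is kept as an argument; on a connected graph the value does
  not depend on it.  There the expected hitting times are also finite, so \<open>enn2real\<close> loses nothing.
\<close>

definition kemeny :: "'a pair_pre_digraph \<Rightarrow> 'a \<Rightarrow> real" where
  "kemeny G i = (\<Sum>j\<in>pverts G. stationary G j * enn2real (expected_hitting_time G i j))"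

end

theory Submission
  imports Defs
begin

text \<open>
  Every tree arises from a single vertex by attaching leaves, and its distance \<open>d\<close> extends
  along.  Solving the one-step equations gives the expected hitting times
  \<open>h(i,j) = 1/2 (\<Sum>k. deg k (d(i,j) + d(k,j) - d(i,k)))\<close>, hence Kemeny's constant is
  \<open>S / (4 (n - 1))\<close> with \<open>S = (\<Sum>j k. deg j deg k d(j,k))\<close>.
  Attaching a leaf to \<open>u\<close> in a tree on \<open>n\<close> vertices increases \<open>S\<close> by \<open>4 D(u) + 4 n - 2\<close>,
  where \<open>D(u) = (\<Sum>k. deg k d(u,k)) \<le> (n - 1)\<^sup>2\<close>.  On the path, with \<open>u\<close> an end vertex, this
  bound is attained at every step.
\<close>

section \<open>Trees with their distance\<close>

text \<open>The edge joining the new leaf \<open>l\<close> to \<open>u\<close> is the only way to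
  reach \<open>l\<close>. Testing for \<open>l\<close> first keeps the meaningless values of the old
  distance at \<open>l\<close> out of the result as long as \<open>u\<close> differs from
  \<open>l\<close>.\<close>

definition leaf_extension :: "('a \<Rightarrow> 'a \<Rightarrow> real) \<Rightarrow> 'a \<Rightarrow> 'a \<Rightarrow> 'a \<Rightarrow> 'a \<Rightarrow> real" where
  "leaf_extension d u l x y =
     (if x = l then if y = l then 0 else d u y + 1
      else if y = l then d x u + 1 else d x y)"

lemma leaf_extension_simps:
  "leaf_extension d u l l l = 0"
  "y \<noteq> l \<Longrightarrow> leaf_extension d u l l y = d u y + 1"
  "x \<noteq> l \<Longrightarrow> leaf_extension d u l x l = d x u + 1"
  "x \<noteq> l \<Longrightarrow> y \<noteq> l \<Longrightarrow> leaf_extension d u l x y = d x y"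
  by (simp_all add: leaf_extension_def)

text \<open>Vertices, arcs and distance grow together, so every metric fact below is an induction
  over leaf attachments. Only the values of the distance on pairs from the vertex set carry
  meaning.\<close>

inductive tree_metric :: "'a set \<Rightarrow> 'a rel \<Rightarrow> ('a \<Rightarrow> 'a \<Rightarrow> real) \<Rightarrow> bool" where
  single: "tree_metric {v} {} (\<lambda>_ _. 0)"
| leaf: "tree_metric V E d \<Longrightarrow> u \<in> V \<Longrightarrow> l \<notin> V \<Longrightarrow>
    tree_metric (insert l V) (insert (u, l) (insert (l, u) E)) (leaf_extension d u l)"

lemma tree_metric_wf:
  assumes "tree_metric V E d"
  shows "finite V" "V \<noteq> {}" "E \<subseteq> V \<times> V"
  using assms by induction auto

lemma tree_metric_finite_arcs: "tree_metric V E d \<Longrightarrow> finite E"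
  using tree_metric_wf(1,3)[of V E d] by (meson finite_SigmaI finite_subset)

lemma tree_metric_finite_nbrs: "tree_metric V E d \<Longrightarrow> finite (E `` {v})"
  by (simp add: tree_metric_finite_arcs)

lemma tree_metric_sym: "tree_metric V E d \<Longrightarrow> x \<in> V \<Longrightarrow> y \<in> V \<Longrightarrow> d x y = d y x"
  by (induction arbitrary: x y rule: tree_metric.induct) (auto simp: leaf_extension_def)

lemma tree_metric_refl: "tree_metric V E d \<Longrightarrow> x \<in> V \<Longrightarrow> d x x = 0"
  by (induction arbitrary: x rule: tree_metric.induct) (auto simp: leaf_extension_def)

lemma tree_metric_nonneg: "tree_metric V E d \<Longrightarrow> x \<in> V \<Longrightarrow> y \<in> V \<Longrightarrow> 0 \<le> d x y"
  by (induction arbitrary: x y rule: tree_metric.induct) (auto simp: leaf_extension_def)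

lemma tree_metric_triangle:
  "tree_metric V E d \<Longrightarrow> x \<in> V \<Longrightarrow> y \<in> V \<Longrightarrow> z \<in> V \<Longrightarrow> d x z \<le> d x y + d y z"
proof (induction arbitrary: x y z rule: tree_metric.induct)
  case (leaf V E d u l)
  note m = tree_metric_refl[OF leaf.hyps(1)] tree_metric_nonneg[OF leaf.hyps(1)]
  have "d a c \<le> d a b + d b c" if "a \<in> V" "b \<in> V" "c \<in> V" for a b c
    using leaf.IH that by blast
  then show ?case
    using leaf.prems leaf.hyps(2,3) m(1)[of u] m(2)[of u] m(2)[of _ u]
    by (auto simp: leaf_extension_def) (smt (verit))+
qed simp

text \<open>A new leaf lengthens distances by at most one and enlarges the vertex set by one. This
  controls the increment in \<open>weighted_distance_le\<close>.\<close>

lemma tree_metric_diameter: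
  "tree_metric V E d \<Longrightarrow> x \<in> V \<Longrightarrow> y \<in> V \<Longrightarrow> d x y \<le> real (card V) - 1"
proof (induction arbitrary: x y rule: tree_metric.induct)
  case (leaf V E d u l)
  have "finite V" using leaf.hyps(1) by (rule tree_metric_wf)
  moreover have "d a b \<le> real (card V) - 1" if "a \<in> V" "b \<in> V" for a b
    using leaf.IH that by blast
  moreover have "card V > 0"
    using \<open>finite V\<close> leaf.hyps(2) by (auto simp: card_gt_0_iff)
  ultimately show ?case
    using leaf.prems leaf.hyps(2,3) by (auto simp: leaf_extension_def) (smt (verit))+
qed simp

lemma leaf_nbrs:
  assumes "tree_metric V E d" "u \<in> V" "l \<notin> V"
  defines "E' \<equiv> insert (u, l) (insert (l, u) E)"
  shows "E' `` {l} = {u}" "E' `` {u} = insert l (E `` {u})"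
    "v \<in> V \<Longrightarrow> v \<noteq> u \<Longrightarrow> E' `` {v} = E `` {v}" "l \<notin> E `` {v}"
  using assms tree_metric_wf(3)[OF assms(1)] by auto

lemma leaf_degree:
  assumes "tree_metric V E d" "u \<in> V" "l \<notin> V"
  defines "E' \<equiv> insert (u, l) (insert (l, u) E)"
  shows "card (E' `` {l}) = 1"
    "v \<in> V \<Longrightarrow> card (E' `` {v}) = card (E `` {v}) + (if v = u then 1 else 0)"
  unfolding E'_def
  by (simp_all add: leaf_nbrs[OF assms(1-3)] leaf_nbrs(4)[OF assms(1-3), simplified]
      tree_metric_finite_nbrs[OF assms(1)])

text \<open>Exactly one neighbour of \<open>v\<close> is closer to \<open>j \<noteq> v\<close>, all others are farther away.\<close>

lemma tree_metric_laplacian: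
  "tree_metric V E d \<Longrightarrow> v \<in> V \<Longrightarrow> j \<in> V \<Longrightarrow>
    (\<Sum>w\<in>E `` {v}. d w j) = real (card (E `` {v})) * (d v j + 1) - (if v = j then 0 else 2)"
proof (induction arbitrary: v j rule: tree_metric.induct)
  case (leaf V E d u l)
  note nb = leaf_nbrs[OF leaf.hyps]
  note fin = tree_metric_finite_nbrs[OF leaf.hyps(1)]
  note uu = tree_metric_refl[OF leaf.hyps(1,2)]
  note [simp] = leaf.hyps(2,3)
  have lu: "l \<noteq> u" using leaf.hyps(2,3) by blast
  define E' where "E' = insert (u, l) (insert (l, u) E)"
  note nb = nb[folded E'_def]
  have IH: "(\<Sum>w\<in>E `` {v}. d w j) = real (card (E `` {v})) * (d v j + 1) - (if v = j then 0 else 2)"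
    if "v \<in> V" "j \<in> V" for v j using leaf.IH that by blast
  \<comment> \<open>Old neighbours are never \<open>l\<close>, and their distance to
    \<open>l\<close> is one more than that to \<open>u\<close>. So a target \<open>l\<close> reduces
    to the induction hypothesis for the target \<open>u\<close>.\<close>
  have old: "(\<Sum>w\<in>E `` {v}. leaf_extension d u l w j) =
      (\<Sum>w\<in>E `` {v}. d w (if j = l then u else j)) + (if j = l then real (card (E `` {v})) else 0)" for v j
  proof -
    have "(\<Sum>w\<in>E `` {v}. leaf_extension d u l w j) =
        (\<Sum>w\<in>E `` {v}. d w (if j = l then u else j) + (if j = l then 1 else 0))"
      using nb(4)[of v] by (intro sum.cong) (auto simp: leaf_extension_def)
    then show ?thesis by (simp add: sum.distrib)
  qed
  show ?case unfolding E'_def[symmetric]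
  proof (cases "v = l")
    case True
    then show "(\<Sum>w\<in>E' `` {v}. leaf_extension d u l w j) =
      real (card (E' `` {v})) * (leaf_extension d u l v j + 1) - (if v = j then 0 else 2)"
      using leaf.prems lu by (auto simp: nb(1) leaf_extension_def uu)
  next
    case False
    with leaf.prems have v: "v \<in> V" by simp
    have "j = l \<or> j \<in> V" using leaf.prems by auto
    then show "(\<Sum>w\<in>E' `` {v}. leaf_extension d u l w j) =
      real (card (E' `` {v})) * (leaf_extension d u l v j + 1) - (if v = j then 0 else 2)"
    proof
      assume j: "j = l"
      show ?thesis
      proof (cases "v = u")
        case True
        then show ?thesis using j lu IH[of u u] fin[of u] nb(4)[of u]
          by (simp add: nb(2) old uu leaf_extension_simps algebra_simps)
      next
        case False
        then show ?thesis using j v \<open>v \<noteq> l\<close> IH[OF v, of u]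
          by (simp add: nb(3) old leaf_extension_simps algebra_simps)
      qed
    next
      assume j: "j \<in> V"
      then have "j \<noteq> l" by auto
      show ?thesis
      proof (cases "v = u")
        case True
        then show ?thesis using j \<open>j \<noteq> l\<close> lu IH[of u j] fin[of u] nb(4)[of u]
          by (simp add: nb(2) old leaf_extension_simps algebra_simps)
      next
        case False
        then show ?thesis using j \<open>j \<noteq> l\<close> v \<open>v \<noteq> l\<close> IH[OF v j]
          by (simp add: nb(3) old leaf_extension_simps algebra_simps)
      qed
    qed
  qed
qed simp

section \<open>Degree-weighted distance sums under leaf attachment\<close>

definition weighted_distance :: "'a set \<Rightarrow> 'a rel \<Rightarrow> ('a \<Rightarrow> 'a \<Rightarrow> real) \<Rightarrow> 'a \<Rightarrow> real" where
  "weighted_distance V E d j = (\<Sum>k\<in>V. real (card (E `` {k})) * d j k)"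

text \<open>This is twice the Gutman index, because ordered pairs are summed.\<close>

definition gutman :: "'a set \<Rightarrow> 'a rel \<Rightarrow> ('a \<Rightarrow> 'a \<Rightarrow> real) \<Rightarrow> real" where
  "gutman V E d = (\<Sum>j\<in>V. real (card (E `` {j})) * weighted_distance V E d j)"

text \<open>The new edge raises the degree of \<open>u\<close> by one and gives \<open>l\<close>
  degree one, which accounts for the two extra terms. Keeping \<open>f\<close> arbitrary lets this
  serve the degree sum, \<open>weighted_distance\<close> and \<open>gutman\<close> alike.\<close>

lemma leaf_degree_sum:
  assumes "tree_metric V E d" "u \<in> V" "l \<notin> V"
  defines "E' \<equiv> insert (u, l) (insert (l, u) E)"
  shows "(\<Sum>k\<in>insert l V. real (card (E' `` {k})) * f k) =
     (\<Sum>k\<in>V. real (card (E `` {k})) * f k) + f u + f l"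
proof -
  have fin: "finite V" using assms(1) by (rule tree_metric_wf)
  have "(\<Sum>k\<in>V. real (card (E' `` {k})) * f k) =
      (\<Sum>k\<in>V. real (card (E `` {k})) * f k + (if k = u then f k else 0))"
    unfolding E'_def by (intro sum.cong refl) (simp add: leaf_degree(2)[OF assms(1-3)] algebra_simps)
  also have "\<dots> = (\<Sum>k\<in>V. real (card (E `` {k})) * f k) + f u"
    using fin assms(2) by (simp add: sum.distrib)
  finally show ?thesis
    using fin assms(3) leaf_degree(1)[OF assms(1-3)] by (simp add: E'_def)
qed

lemma tree_metric_degree_sum:
  "tree_metric V E d \<Longrightarrow> (\<Sum>k\<in>V. real (card (E `` {k}))) = 2 * (real (card V) - 1)"
proof (induction rule: tree_metric.induct)
  case (leaf V E d u l)
  then show ?case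
    using leaf_degree_sum[OF leaf.hyps, of "\<lambda>_. 1"] tree_metric_wf(1)[OF leaf.hyps(1)]
    by simp
qed simp

text \<open>Seen from an old \<open>j\<close>, the extra degree at \<open>u\<close> costs
  \<open>d j u\<close> and the leaf costs \<open>d j u + 1\<close>. Seen from \<open>l\<close>, all
  old distances from \<open>u\<close> grow by one, which adds the total degree
  \<open>2 * (card V - 1)\<close>, and the extra degree at \<open>u\<close> adds one more.\<close>

lemma weighted_distance_leaf:
  assumes T: "tree_metric V E d" "u \<in> V" "l \<notin> V"
  defines "E' \<equiv> insert (u, l) (insert (l, u) E)"
  shows "j \<in> V \<Longrightarrow> weighted_distance (insert l V) E' (leaf_extension d u l) j =
      weighted_distance V E d j + 2 * d j u + 1"
    and "weighted_distance (insert l V) E' (leaf_extension d u l) l =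
      weighted_distance V E d u + 2 * real (card V) - 1"
proof -
  have lu: "l \<noteq> u" using T by auto
  have eq: "(\<Sum>k\<in>V. real (card (E `` {k})) * leaf_extension d u l j k) =
      (\<Sum>k\<in>V. real (card (E `` {k})) * (if j = l then d u k + 1 else d j k))" for j
    using T(3) by (intro sum.cong) (auto simp: leaf_extension_def)
  show "weighted_distance (insert l V) E' (leaf_extension d u l) j =
      weighted_distance V E d j + 2 * d j u + 1" if "j \<in> V"
    using that T(3) lu unfolding weighted_distance_def E'_def leaf_degree_sum[OF T] eq
    by (auto simp: leaf_extension_def)
  show "weighted_distance (insert l V) E' (leaf_extension d u l) l =
      weighted_distance V E d u + 2 * real (card V) - 1"
    using lu unfolding weighted_distance_def E'_def leaf_degree_sum[OF T] eq
    by (auto simp: leaf_extension_def tree_metric_refl[OF T(1,2)] distrib_left sum.distrib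
      tree_metric_degree_sum[OF T(1)])
qed

text \<open>Write \<open>D\<close> for the weighted distance of \<open>u\<close> and
  \<open>n\<close> for \<open>card V\<close>. Old vertices with their old degrees add
  \<open>2 * D + 2 * (n - 1)\<close>, the extra degree at \<open>u\<close> adds
  \<open>D + 1\<close>, and the leaf adds \<open>D + 2 * n - 1\<close>.\<close>

lemma gutman_leaf:
  assumes T: "tree_metric V E d" "u \<in> V" "l \<notin> V"
  shows "gutman (insert l V) (insert (u, l) (insert (l, u) E)) (leaf_extension d u l) =
    gutman V E d + 4 * weighted_distance V E d u + 4 * real (card V) - 2"
proof -
  have "(\<Sum>k\<in>V. real (card (E `` {k})) *
      weighted_distance (insert l V) (insert (u, l) (insert (l, u) E)) (leaf_extension d u l) k) =
    (\<Sum>k\<in>V. real (card (E `` {k})) * weighted_distance V E d k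
       + 2 * (real (card (E `` {k})) * d u k) + real (card (E `` {k})))"
    using T(2) by (intro sum.cong refl)
      (simp add: weighted_distance_leaf[OF T] tree_metric_sym[OF T(1)] algebra_simps)
  also have "\<dots> = gutman V E d + 2 * weighted_distance V E d u + 2 * (real (card V) - 1)"
    by (simp add: sum.distrib gutman_def weighted_distance_def sum_distrib_left
        tree_metric_degree_sum[OF T(1)])
  finally show ?thesis
    using T(2) unfolding gutman_def[of "insert l V"] leaf_degree_sum[OF T]
    by (simp add: weighted_distance_leaf[OF T] tree_metric_refl[OF T(1)])
qed

text \<open>With \<open>n = card V\<close>, the allowed growth is
  \<open>n\<^sup>2 - (n - 1)\<^sup>2 = 2 * n - 1\<close>. From the leaf this is exactly the growth
  over the value at \<open>u\<close>; from an old vertex the growth \<open>2 * d j u + 1\<close>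
  stays below it by the diameter bound.\<close>

lemma weighted_distance_le:
  "tree_metric V E d \<Longrightarrow> j \<in> V \<Longrightarrow> weighted_distance V E d j \<le> (real (card V) - 1)\<^sup>2"
proof (induction arbitrary: j rule: tree_metric.induct)
  case (leaf V E d u l)
  have fin: "finite V" using leaf.hyps(1) by (rule tree_metric_wf)
  have IH: "weighted_distance V E d j \<le> (real (card V) - 1)\<^sup>2" if "j \<in> V" for j
    using leaf.IH that by blast
  show ?case
    using leaf.prems fin leaf.hyps(3) IH[OF leaf.hyps(2)] IH[of j]
      tree_metric_diameter[OF leaf.hyps(1) _ leaf.hyps(2), of j]
    by (auto simp: weighted_distance_leaf[OF leaf.hyps] power2_eq_square algebra_simps)
qed (simp add: weighted_distance_def)

text \<open>The summand is the increment from \<open>gutman_leaf\<close> for a tree on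
  \<open>m\<close> vertices when the weighted distance at \<open>u\<close> is extremal. Leaving the
  sum unevaluated allows a comparison step by step.\<close>

definition path_gutman :: "nat \<Rightarrow> real" where
  "path_gutman n = (\<Sum>m\<in>{1..<n}. 4 * (real m - 1)\<^sup>2 + 4 * real m - 2)"

lemma gutman_le: "tree_metric V E d \<Longrightarrow> gutman V E d \<le> path_gutman (card V)"
proof (induction rule: tree_metric.induct)
  case (leaf V E d u l)
  have fin: "finite V" using leaf.hyps(1) by (rule tree_metric_wf)
  have "card V \<ge> 1" using fin leaf.hyps(2) by (auto simp: Suc_le_eq card_gt_0_iff)
  then have "path_gutman (Suc (card V)) =
      path_gutman (card V) + (4 * (real (card V) - 1)\<^sup>2 + 4 * real (card V) - 2)"
    by (simp add: path_gutman_def)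
  then show ?case
    using leaf.IH fin leaf.hyps(3) weighted_distance_le[OF leaf.hyps(1,2)]
    by (simp add: gutman_leaf[OF leaf.hyps])
qed (simp add: gutman_def path_gutman_def)

text \<open>The weighted distance of the end vertex \<open>n\<close> is carried through the
  induction because the next leaf is attached there. Its value is the maximum allowed by
  \<open>weighted_distance_le\<close>.\<close>

lemma path_graph_tree_metric:
  "\<exists>d. tree_metric (pverts (path_graph (Suc n))) (parcs (path_graph (Suc n))) d \<and>
     weighted_distance (pverts (path_graph (Suc n))) (parcs (path_graph (Suc n))) d n = (real n)\<^sup>2 \<and>
     gutman (pverts (path_graph (Suc n))) (parcs (path_graph (Suc n))) d = path_gutman (Suc n)"
proof (induction n)
  case 0
  have "pverts (path_graph (Suc 0)) = {0}" "parcs (path_graph (Suc 0)) = {}"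
    by (auto simp: path_graph_def)
  then show ?case
    using tree_metric.single[of "0::nat"]
    by (intro exI[of _ "\<lambda>_ _. 0"]) (simp add: weighted_distance_def gutman_def path_gutman_def)
next
  case (Suc n)
  let ?V = "pverts (path_graph (Suc n))" and ?E = "parcs (path_graph (Suc n))"
  from Suc obtain d where d: "tree_metric ?V ?E d" "weighted_distance ?V ?E d n = (real n)\<^sup>2"
    "gutman ?V ?E d = path_gutman (Suc n)" by blast
  have eq: "pverts (path_graph (Suc (Suc n))) = insert (Suc n) ?V"
    "parcs (path_graph (Suc (Suc n))) = insert (n, Suc n) (insert (Suc n, n) ?E)"
    by (auto simp: path_graph_def)
  have n: "n \<in> ?V" "Suc n \<notin> ?V" "card ?V = Suc n" by (auto simp: path_graph_def)
  show ?case unfolding eq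
    using tree_metric.leaf[OF d(1) n(1,2)] n(3)
    by (intro exI[of _ "leaf_extension d n (Suc n)"])
      (auto simp: weighted_distance_leaf[OF d(1) n(1,2)] gutman_leaf[OF d(1) n(1,2)] d(2,3)
        path_gutman_def power2_eq_square algebra_simps)
qed

lemma tree_metric_card_edges:
  "tree_metric V E d \<Longrightarrow> card ((\<lambda>(u, v). {u, v}) ` E) = card V - 1"
proof (induction rule: tree_metric.induct)
  case (leaf V E d u l)
  have "{u, l} \<notin> (\<lambda>(u, v). {u, v}) ` E"
    using tree_metric_wf(3)[OF leaf.hyps(1)] leaf.hyps(3) by (auto simp: doubleton_eq_iff)
  moreover have "card V > 0"
    using tree_metric_wf(1)[OF leaf.hyps(1)] leaf.hyps(2) by (auto simp: card_gt_0_iff)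
  ultimately show ?case
    using leaf.IH leaf.hyps(3) tree_metric_wf(1)[OF leaf.hyps(1)] tree_metric_finite_arcs[OF leaf.hyps(1)]
    by (simp add: insert_commute)
qed simp

section \<open>Undirected trees\<close>

lemma pcas_snoc:
  assumes "pcas x p b"
  shows "pcas x (p @ [(b, c)]) c" "pawalk_verts x (p @ [(b, c)]) = pawalk_verts x p @ [c]"
  using assms by (induction p arbitrary: x) auto

text \<open>The leaf is only ever an end of the constructed path, so distinctness survives. Since
  \<open>pcas\<close> and \<open>pawalk_verts\<close> mention no graph, the path can be reused
  inside any graph containing \<open>E\<close>.\<close>

lemma tree_metric_path:
  "tree_metric V E d \<Longrightarrow> x \<in> V \<Longrightarrow> y \<in> V \<Longrightarrow>
    \<exists>p. pcas x p y \<and> set p \<subseteq> E \<and> distinct (pawalk_verts x p) \<and> set (pawalk_verts x p) \<subseteq> V"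
proof (induction arbitrary: x y rule: tree_metric.induct)
  case (single v)
  then show ?case by (intro exI[of _ "[]"]) auto
next
  case (leaf V E d u l)
  consider "x = l" "y = l" | "x = l" "y \<in> V" | "x \<in> V" "y = l" | "x \<in> V" "y \<in> V"
    using leaf.prems by blast
  then show ?case
  proof cases
    case 1
    then show ?thesis by (intro exI[of _ "[]"]) auto
  next
    case 2
    then obtain p where "pcas u p y" "set p \<subseteq> E" "distinct (pawalk_verts u p)" "set (pawalk_verts u p) \<subseteq> V"
      using leaf.IH[OF leaf.hyps(2)] by blast
    then show ?thesis using 2 leaf.hyps by (intro exI[of _ "(l, u) # p"]) auto
  next
    case 3
    then obtain p where "pcas x p u" "set p \<subseteq> E" "distinct (pawalk_verts x p)" "set (pawalk_verts x p) \<subseteq> V"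
      using leaf.IH[OF _ leaf.hyps(2)] by blast
    then show ?thesis using 3 leaf.hyps by (intro exI[of _ "p @ [(u, l)]"]) (auto simp: pcas_snoc)
  next
    case 4
    then show ?thesis using leaf.IH by (meson subset_insertI2)
  qed
qed

text \<open>Two distinct neighbours of \<open>l\<close> in \<open>S\<close> would be joined by a
  simple path inside \<open>S\<close>, and going through \<open>l\<close> would close it to a
  cycle.\<close>

lemma undirected_tree_unique_nbr:
  assumes T: "undirected_tree T"
    and S: "tree_metric S E d" "S \<subseteq> pverts T" "E \<subseteq> parcs T"
    and l: "l \<notin> S" "(u, l) \<in> parcs T" "(u', l) \<in> parcs T" "u \<in> S" "u' \<in> S"
  shows "u = u'"
proof (rule ccontr)
  assume neq: "u \<noteq> u'"
  interpret pair_graph T using T by (simp add: undirected_tree_def)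
  obtain p where p: "pcas u p u'" "set p \<subseteq> E" "distinct (pawalk_verts u p)" "set (pawalk_verts u p) \<subseteq> S"
    using tree_metric_path[OF S(1) l(4,5)] by blast
  have "cycle ((l, u) # p @ [(u', l)])"
    unfolding cycle_def awalk_def using p S l pcas_snoc[OF p(1), of l]
    by (intro exI[of _ l]) (auto intro: arcs_symmetric in_arcsD2)
  \<comment> \<open>A nonempty path makes the cycle have length at least 3, which rules out mere
    backtracking along one edge.\<close>
  moreover have "p \<noteq> []" using p(1) neq by auto
  ultimately have "cycle ((l, u) # p @ [(u', l)]) \<and> 3 \<le> length ((l, u) # p @ [(u', l)])"
    by (cases p) auto
  then show False using T unfolding undirected_tree_def by blast
qed

text \<open>A walk from inside \<open>S\<close> to outside must contain a first arc that leaves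
  \<open>S\<close>.\<close>

lemma undirected_tree_boundary_arc:
  assumes T: "undirected_tree T" and S: "S \<subset> pverts T" "S \<noteq> {}"
  shows "\<exists>u l. (u, l) \<in> parcs T \<and> u \<in> S \<and> l \<in> pverts T - S"
proof -
  interpret pair_graph T using T by (simp add: undirected_tree_def)
  from S obtain a b where ab: "a \<in> S" "b \<in> pverts T - S" by blast
  have "strongly_connected (with_proj T)"
    using T sym_arcs by (auto simp: undirected_tree_def intro: symmetric_connected_imp_strongly_connected)
  then have "a \<rightarrow>\<^sup>*\<^bsub>with_proj T\<^esub> b"
    using ab S by (auto simp: strongly_connected_def)
  then obtain p where p: "awalk a p b" by (auto simp: reachable_awalk)
  have "set p \<subseteq> parcs T \<Longrightarrow> pcas x p b \<Longrightarrow> x \<in> S \<Longrightarrow> ?thesis" for x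
  proof (induction p arbitrary: x)
    case Nil
    then show ?case using ab by auto
  next
    case (Cons e p)
    then show ?case by (cases e; cases "snd e \<in> S") (auto intro: in_arcsD2)
  qed
  with p ab show ?thesis by (auto simp: awalk_def)
qed

text \<open>Working with the arcs induced on \<open>S\<close> ensures that no arc of
  \<open>T\<close> is missing once \<open>S\<close> is the whole vertex set.\<close>

lemma undirected_tree_grow:
  assumes T: "undirected_tree T" and "m < card (pverts T)"
  shows "\<exists>S d. S \<subseteq> pverts T \<and> card S = Suc m \<and> tree_metric S (parcs T \<inter> S \<times> S) d"
  using assms(2)
proof (induction m)
  case 0
  interpret pair_graph T using T by (simp add: undirected_tree_def)
  from 0 obtain v where "v \<in> pverts T" by fastforce
  moreover have "parcs T \<inter> {v} \<times> {v} = {}" using no_loops' by auto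
  ultimately show ?case using tree_metric.single[of v]
    by (intro exI[of _ "{v}"] exI[of _ "\<lambda>_ _. 0"]) auto
next
  case (Suc m)
  interpret pair_graph T using T by (simp add: undirected_tree_def)
  from Suc obtain S d where S: "S \<subseteq> pverts T" "card S = Suc m" "tree_metric S (parcs T \<inter> S \<times> S) d"
    by auto
  then have "S \<subset> pverts T" "S \<noteq> {}" using Suc.prems by auto
  then obtain u l where ul: "(u, l) \<in> parcs T" "u \<in> S" "l \<in> pverts T" "l \<notin> S"
    using undirected_tree_boundary_arc[OF T] by blast
  \<comment> \<open>As \<open>u\<close> is the only neighbour of \<open>l\<close> in
    \<open>S\<close>, the induced arc set grows by exactly one edge, as the rule \<open>leaf\<close>
    demands.\<close>
  have "u' = u" if "(u', l) \<in> parcs T" "u' \<in> S" for u'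
    using undirected_tree_unique_nbr[OF T S(3,1) _ ul(4) that(1) ul(1) that(2) ul(2)] by auto
  then have "parcs T \<inter> insert l S \<times> insert l S = insert (u, l) (insert (l, u) (parcs T \<inter> S \<times> S))"
    using ul arcs_symmetric[of u l] no_loops'[of l l] by (blast dest: arcs_symmetric[of l])
  then have "tree_metric (insert l S) (parcs T \<inter> insert l S \<times> insert l S) (leaf_extension d u l)"
    using tree_metric.leaf[OF S(3) ul(2,4)] by simp
  then show ?case using S ul tree_metric_wf(1)[OF S(3)]
    by (intro exI[of _ "insert l S"] exI[of _ "leaf_extension d u l"]) auto
qed

lemma undirected_tree_tree_metric:
  assumes T: "undirected_tree T"
  shows "\<exists>d. tree_metric (pverts T) (parcs T) d"
proof -
  interpret pair_graph T using T by (simp add: undirected_tree_def)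
  have "pverts T \<noteq> {}"
    using T by (auto simp: undirected_tree_def connected_conv)
  then have pos: "card (pverts T) > 0" using pair_finite_verts by (simp add: card_gt_0_iff)
  then obtain S d where S: "S \<subseteq> pverts T" "card S = card (pverts T)" "tree_metric S (parcs T \<inter> S \<times> S) d"
    using undirected_tree_grow[OF T, of "card (pverts T) - 1"] by auto
  then have "S = pverts T" using pair_finite_verts by (simp add: card_subset_eq)
  moreover from this have "parcs T \<inter> S \<times> S = parcs T"
    by (auto dest: in_arcsD1 in_arcsD2)
  ultimately show ?thesis using S(3) by auto
qed

section \<open>Hitting times of the random walk\<close>

lemma sets_walk_measure: "sets (walk_measure G i) = sets (PiM UNIV (\<lambda>_. count_space UNIV))"
  unfolding walk_measure_def by (rule walk.PF.sets_lim)

lemma space_walk_measure [simp]: "space (walk_measure G i) = UNIV"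
  using sets_eq_imp_space_eq[OF sets_walk_measure] by (simp add: space_PiM)

lemma measurable_walk_coordinate [measurable]:
  "(\<lambda>\<omega>. \<omega> t) \<in> measurable (walk_measure G i) (count_space UNIV)"
  unfolding measurable_cong_sets[OF sets_walk_measure refl]
  by (rule measurable_component_singleton) simp

text \<open>Integrals over infinite trajectories that see only the first \<open>n\<close> positions
  reduce to the finite kernel composition, where single steps can be computed.\<close>

lemma walk_marginal:
  fixes G :: "'a pair_pre_digraph"
  assumes f: "f \<in> borel_measurable (PiM {0..<n} (\<lambda>_. count_space UNIV))"
  shows "(\<integral>\<^sup>+\<omega>. f (restrict \<omega> {0..<n}) \<partial>walk_measure G i) =
    (\<integral>\<^sup>+\<omega>. f \<omega> \<partial>walk.C G i 0 n (\<lambda>_. undefined))"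
proof -
  let ?M = "\<lambda>J. PiM J (\<lambda>_::nat. count_space (UNIV :: 'a set))"
  \<comment> \<open>This function is the only point of the product over the empty index set, that
    is, the empty history.\<close>
  have start: "(\<lambda>_. undefined) \<in> space (?M {0..<0})"
    by (simp add: space_PiM)
  have "walk.CI G i {0..<n} = walk.C G i 0 n (\<lambda>_. undefined)"
  proof (rule measure_eqI)
    show "sets (walk.CI G i {0..<n}) = sets (walk.C G i 0 n (\<lambda>_. undefined))"
      using walk.sets_C[OF start] by (simp add: walk.CI_def)
    fix X assume "X \<in> sets (walk.CI G i {0..<n})"
    then have X: "X \<in> sets (?M {0..<n})" by (simp add: walk.CI_def)
    then have "X \<subseteq> (\<Pi>\<^sub>E k\<in>{0..<n}. space (count_space UNIV))"
      using sets.sets_into_space[OF X] by (simp add: space_PiM)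
    then show "emeasure (walk.CI G i {0..<n}) X = emeasure (walk.C G i 0 n (\<lambda>_. undefined)) X"
      using walk.emeasure_CI[OF subset_refl X] by (simp add: prod_emb_id)
  qed
  then have "distr (walk_measure G i) (?M {0..<n}) (\<lambda>\<omega>. restrict \<omega> {0..<n}) =
      walk.C G i 0 n (\<lambda>_. undefined)"
    unfolding walk_measure_def by (simp add: walk.distr_lim)
  moreover have "(\<lambda>\<omega>. restrict \<omega> {0..<n}) \<in> measurable (walk_measure G i) (?M {0..<n})"
    by (intro measurable_restrict measurable_walk_coordinate)
  ultimately show ?thesis
    using nn_integral_distr[of "\<lambda>\<omega>. restrict \<omega> {0..<n}" "walk_measure G i" "?M {0..<n}" f] f
    by (metis measurable_distr_eq1)
qed

lemma walk_start: "(\<integral>\<^sup>+\<omega>. \<phi> (\<omega> 0) \<partial>walk_measure G i) = \<phi> i"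
proof -
  let ?M = "PiM {0..<1} (\<lambda>_::nat. count_space UNIV)"
  have meas: "(\<lambda>\<omega>. \<phi> (\<omega> 0)) \<in> borel_measurable ?M"
    by (rule measurable_compose[OF measurable_component_singleton]) auto
  have s: "(\<lambda>_. undefined) \<in> space (PiM {0..<0} (\<lambda>_::nat. count_space UNIV))"
    by (simp add: space_PiM)
  have "(\<integral>\<^sup>+\<omega>. \<phi> (\<omega> 0) \<partial>walk_measure G i) = (\<integral>\<^sup>+\<omega>. \<phi> (\<omega> 0) \<partial>walk.C G i 0 1 (\<lambda>_. undefined))"
    using walk_marginal[OF meas, of G i] by simp
  also have "walk.C G i 0 1 (\<lambda>_. undefined) = walk.eP G i 0 (\<lambda>_. undefined)"
    using bind_return[OF walk.measurable_eP s] by simp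
  also have "(\<integral>\<^sup>+\<omega>. \<phi> (\<omega> 0) \<partial>walk.eP G i 0 (\<lambda>_. undefined)) = \<phi> i"
    using walk.nn_integral_eP[OF s, of "\<lambda>\<omega>. \<phi> (\<omega> 0)"] meas
    by (simp add: nn_integral_return)
  finally show ?thesis .
qed

text \<open>The Markov property in integrated form: \<open>A\<close> is an arbitrary weight
  depending on the history up to time \<open>t\<close>, and the next position is averaged over the
  neighbours of the current one.\<close>

lemma walk_step:
  fixes G :: "'a pair_pre_digraph" and \<phi> :: "'a \<Rightarrow> ennreal"
  assumes A[measurable]: "A \<in> borel_measurable (PiM {0..<Suc t} (\<lambda>_. count_space UNIV))"
  shows "(\<integral>\<^sup>+\<omega>. A (restrict \<omega> {0..<Suc t}) * \<phi> (\<omega> (Suc t)) \<partial>walk_measure G i) =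
    (\<integral>\<^sup>+\<omega>. A (restrict \<omega> {0..<Suc t}) *
       (\<integral>\<^sup>+w. \<phi> w \<partial>measure_pmf (pmf_of_set {w. (\<omega> t, w) \<in> parcs G})) \<partial>walk_measure G i)"
proof -
  let ?M = "\<lambda>J. PiM J (\<lambda>_::nat. count_space (UNIV :: 'a set))"
  let ?K = "\<lambda>v. \<integral>\<^sup>+w. \<phi> w \<partial>measure_pmf (pmf_of_set {w. (v, w) \<in> parcs G})"
  define f where "f = (\<lambda>\<omega>. A (restrict \<omega> {0..<Suc t}) * \<phi> (\<omega> (Suc t)))"
  have \<phi>: "(\<lambda>\<omega>. \<phi> (\<omega> (Suc t))) \<in> borel_measurable (?M {0..<Suc (Suc t)})"
    by (rule measurable_compose[OF measurable_component_singleton]) auto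
  have K: "(\<lambda>\<omega>. ?K (\<omega> t)) \<in> borel_measurable (?M {0..<Suc t})"
    by (rule measurable_compose[OF measurable_component_singleton]) auto
  have "(\<lambda>\<omega>. restrict \<omega> {0..<Suc t}) \<in> measurable (?M {0..<Suc (Suc t)}) (?M {0..<Suc t})"
    by (intro measurable_restrict measurable_component_singleton) auto
  from measurable_compose[OF this A] \<phi>
  have f: "f \<in> borel_measurable (?M {0..<Suc (Suc t)})"
    unfolding f_def by (rule borel_measurable_times_ennreal)
  have start: "(\<lambda>_. undefined) \<in> space (?M {0..<0})"
    by (simp add: space_PiM)
  let ?C = "\<lambda>n. walk.C G i 0 n (\<lambda>_. undefined)"
  have "(\<integral>\<^sup>+\<omega>. A (restrict \<omega> {0..<Suc t}) * \<phi> (\<omega> (Suc t)) \<partial>walk_measure G i) =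
      (\<integral>\<^sup>+\<omega>. f (restrict \<omega> {0..<Suc (Suc t)}) \<partial>walk_measure G i)"
    unfolding f_def by (intro nn_integral_cong) (simp add: Int_absorb1)
  also have "\<dots> = (\<integral>\<^sup>+\<omega>. f \<omega> \<partial>?C (Suc (Suc t)))"
    by (rule walk_marginal[OF f])
  also have "\<dots> = (\<integral>\<^sup>+\<omega>. (\<integral>\<^sup>+\<omega>'. f \<omega>' \<partial>walk.eP G i (Suc t) \<omega>) \<partial>?C (Suc t))"
    unfolding walk.C.simps(2)[of _ _ _ "Suc t"] add_0
    using walk.measurable_eP[of G i "Suc t"] walk.sets_C[OF start, of G i "Suc t"]
    by (intro nn_integral_bind[OF f]) (simp del: walk.C.simps cong: measurable_cong_sets)
  also have "\<dots> = (\<integral>\<^sup>+\<omega>. A \<omega> * ?K (\<omega> t) \<partial>?C (Suc t))"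
  proof (rule nn_integral_cong)
    fix \<omega> assume "\<omega> \<in> space (?C (Suc t))"
    then have \<omega>: "\<omega> \<in> space (?M {0..<Suc t})"
      using walk.space_C[OF start, of G i "Suc t"] by simp
    \<comment> \<open>Appending the position at time \<open>Suc t\<close> leaves the history
      unchanged, so \<open>A\<close> is constant in the inner integral.\<close>
    then have "restrict (fun_upd \<omega> (Suc t) x) {0..<Suc t} = \<omega>" for x
      by (auto simp: space_PiM PiE_def extensional_def restrict_def fun_eq_iff)
    then show "(\<integral>\<^sup>+\<omega>'. f \<omega>' \<partial>walk.eP G i (Suc t) \<omega>) = A \<omega> * ?K (\<omega> t)"
      using walk.nn_integral_eP[OF \<omega> f, of G i]
      by (simp add: f_def nn_integral_cmult)
  qed
  also have "\<dots> = (\<integral>\<^sup>+\<omega>. A (restrict \<omega> {0..<Suc t}) * ?K (restrict \<omega> {0..<Suc t} t) \<partial>walk_measure G i)"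
    by (rule walk_marginal[symmetric]) (intro borel_measurable_times_ennreal A K)
  finally show ?thesis by simp
qed

text \<open>The probability of being outside \<open>V\<close> starts at 0 and cannot increase.
  Nonempty neighbourhoods matter here, since \<open>pmf_of_set\<close> is unspecified on the empty
  set.\<close>

lemma AE_walk_in_verts:
  assumes "finite V" "parcs G \<subseteq> V \<times> V" "\<And>v. v \<in> V \<Longrightarrow> parcs G `` {v} \<noteq> {}" "i \<in> V"
  shows "AE \<omega> in walk_measure G i. \<omega> t \<in> V"
proof -
  have "(\<integral>\<^sup>+\<omega>. indicator (- V) (\<omega> t) \<partial>walk_measure G i) = (0 :: ennreal)"
  proof (induction t)
    case 0
    then show ?case using assms(4) by (simp add: walk_start)
  next
    case (Suc t)
    have "(\<integral>\<^sup>+\<omega>. indicator (- V) (\<omega> (Suc t)) \<partial>walk_measure G i) =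
      (\<integral>\<^sup>+\<omega>. (\<integral>\<^sup>+w. indicator (- V) w \<partial>measure_pmf (pmf_of_set {w. (\<omega> t, w) \<in> parcs G})) \<partial>walk_measure G i)"
      using walk_step[of "\<lambda>_. 1" t G i "indicator (- V)"] by simp
    also have "\<dots> \<le> (\<integral>\<^sup>+\<omega>. indicator (- V) (\<omega> t) \<partial>walk_measure G i)"
    proof (intro nn_integral_mono)
      fix \<omega> :: "nat \<Rightarrow> 'a"
      show "(\<integral>\<^sup>+w. indicator (- V) w \<partial>measure_pmf (pmf_of_set {w. (\<omega> t, w) \<in> parcs G}))
        \<le> (indicator (- V) (\<omega> t) :: ennreal)"
      proof (cases "\<omega> t \<in> V")
        case True
        have "{w. (\<omega> t, w) \<in> parcs G} \<noteq> {}" using assms(3)[OF True] by auto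
        moreover have "finite {w. (\<omega> t, w) \<in> parcs G}"
          by (rule finite_subset[OF _ assms(1)]) (use assms(2) in auto)
        moreover have "{w. (\<omega> t, w) \<in> parcs G} \<inter> - V = {}" using assms(2) by auto
        ultimately show ?thesis by (simp add: emeasure_pmf_of_set)
      next
        case False
        \<comment> \<open>Outside \<open>V\<close> the indicator on the right is 1, so any kernel
          satisfies the bound.\<close>
        then show ?thesis by (simp add: measure_pmf.emeasure_le_1)
      qed
    qed
    finally show ?case using Suc by simp
  qed
  moreover have "(\<lambda>\<omega>. indicator (- V) (\<omega> t) :: ennreal) \<in> borel_measurable (walk_measure G i)"
    by (rule measurable_compose[OF measurable_walk_coordinate]) simp
  ultimately have "AE \<omega> in walk_measure G i. indicator (- V) (\<omega> t) = (0 :: ennreal)"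
    by (simp add: nn_integral_0_iff_AE)
  then show ?thesis by eventually_elim (auto simp: indicator_def split: if_splits)
qed

section \<open>Hitting times and their one-step equations\<close>

lemma less_hitting_time_iff: "enat t < hitting_time j \<omega> \<longleftrightarrow> (\<forall>s\<le>t. \<omega> s \<noteq> j)"
proof
  assume "enat t < hitting_time j \<omega>"
  then show "\<forall>s\<le>t. \<omega> s \<noteq> j"
    unfolding hitting_time_def by (auto dest!: less_INF_D)
next
  assume *: "\<forall>s\<le>t. \<omega> s \<noteq> j"
  have "enat (Suc t) \<le> hitting_time j \<omega>"
    unfolding hitting_time_def using * by (intro INF_greatest) (auto simp: Suc_le_eq not_le[symmetric])
  then show "enat t < hitting_time j \<omega>"
    by (rule less_le_trans[rotated]) simp
qed

text \<open>As \<open>enat\<close> is countable, preimages of single values suffice, and these are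
  described by countably many coordinate conditions.\<close>

lemma measurable_hitting_time:
  "hitting_time j \<in> measurable (walk_measure G i) (count_space UNIV)"
proof -
  have "hitting_time j -` {x} \<inter> space (walk_measure G i) \<in> sets (walk_measure G i)" for x :: enat
  proof (cases x)
    case (enat n)
    have "hitting_time j -` {x} = {\<omega>. (\<forall>s<n. \<omega> s \<noteq> j) \<and> \<omega> n = j}"
    proof -
      have "hitting_time j \<omega> = enat n \<longleftrightarrow> (\<forall>s<n. \<omega> s \<noteq> j) \<and> \<omega> n = j" for \<omega>
      proof -
        have "hitting_time j \<omega> = enat n \<longleftrightarrow> \<not> enat n < hitting_time j \<omega> \<and> (\<forall>m<n. enat m < hitting_time j \<omega>)"
          by (cases "hitting_time j \<omega>") (auto simp: not_less intro: antisym leI)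
        also have "\<dots> \<longleftrightarrow> (\<forall>s<n. \<omega> s \<noteq> j) \<and> \<omega> n = j"
          unfolding less_hitting_time_iff by (auto simp: le_less)
        finally show ?thesis .
      qed
      then show ?thesis using enat by auto
    qed
    moreover have "{\<omega> \<in> space (walk_measure G i). (\<forall>s<n. \<omega> s \<noteq> j) \<and> \<omega> n = j} \<in> sets (walk_measure G i)"
      by measurable
    ultimately show ?thesis by simp
  next
    case infinity
    have "hitting_time j \<omega> = \<infinity> \<longleftrightarrow> (\<forall>n. enat n < hitting_time j \<omega>)" for \<omega>
      by (cases "hitting_time j \<omega>") auto
    then have "hitting_time j -` {x} = {\<omega>. \<forall>s. \<omega> s \<noteq> j}"
      using infinity unfolding less_hitting_time_iff by auto
    moreover have "{\<omega> \<in> space (walk_measure G i). \<forall>s. \<omega> s \<noteq> j} \<in> sets (walk_measure G i)"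
      by measurable
    ultimately show ?thesis by simp
  qed
  moreover have "countable (UNIV :: enat set)" by simp
  ultimately show ?thesis
    by (subst measurable_count_space_eq2_countable) auto
qed


text \<open>A nonnegative solution of the one-step equations that vanishes at \<open>j\<close> must
  be the expected hitting time: iterating the equations leaves a remainder that tends to 0. The
  equations are multiplied by the degree to avoid division.\<close>

lemma expected_hitting_time_eq:
  fixes G :: "'a pair_pre_digraph" and g :: "'a \<Rightarrow> real"
  assumes V: "finite V" "parcs G \<subseteq> V \<times> V" "\<And>v. v \<in> V \<Longrightarrow> parcs G `` {v} \<noteq> {}" "i \<in> V"
    and g: "\<And>v. v \<in> V \<Longrightarrow> 0 \<le> g v" "g j = 0"
    and eq: "\<And>v. v \<in> V \<Longrightarrow> v \<noteq> j \<Longrightarrow>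
      real (card (parcs G `` {v})) * g v = real (card (parcs G `` {v})) + (\<Sum>w\<in>parcs G `` {v}. g w)"
  shows "expected_hitting_time G i j = ennreal (g i)"
proof -
  let ?W = "walk_measure G i"
  define alive :: "nat \<Rightarrow> (nat \<Rightarrow> 'a) \<Rightarrow> ennreal"
    where "alive t \<omega> = (if \<forall>s\<le>t. \<omega> s \<noteq> j then 1 else 0)" for t \<omega>
  have alive_restrict: "alive t (restrict \<omega> {0..<Suc t}) = alive t \<omega>" for t \<omega>
    by (simp add: alive_def)
  have alive_measurable[measurable]: "alive t \<in> borel_measurable ?W" for t
    unfolding alive_def[abs_def] by measurable
  have g_measurable[measurable]: "(\<lambda>\<omega>. ennreal (g (\<omega> t))) \<in> borel_measurable ?W" for t
    by (rule measurable_compose[OF measurable_walk_coordinate]) simp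
  define p where "p t = (\<integral>\<^sup>+\<omega>. alive t \<omega> \<partial>?W)" for t
  define a where "a t = (\<integral>\<^sup>+\<omega>. alive t \<omega> * ennreal (g (\<omega> t)) \<partial>?W)" for t
  have W: "(\<integral>\<^sup>+\<omega>. 1 \<partial>?W) = 1" using walk_start[of G i "\<lambda>_. 1"] .

  have ae: "AE \<omega> in ?W. \<omega> t \<in> V" for t
    by (rule AE_walk_in_verts) (use V in auto)

  have step: "(\<integral>\<^sup>+w. ennreal (g w) \<partial>measure_pmf (pmf_of_set {w. (v, w) \<in> parcs G})) + 1 = ennreal (g v)"
    if v: "v \<in> V" "v \<noteq> j" for v
  proof -
    let ?N = "parcs G `` {v}"
    have N: "{w. (v, w) \<in> parcs G} = ?N" "?N \<noteq> {}" "?N \<subseteq> V" using V(2) V(3)[OF v(1)] by auto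
    then have fin: "finite ?N" using V(1) finite_subset by blast
    have "(\<integral>\<^sup>+w. ennreal (g w) \<partial>measure_pmf (pmf_of_set ?N)) = (\<Sum>w\<in>?N. ennreal (g w)) / real (card ?N)"
      using N fin by (simp add: nn_integral_pmf_of_set ennreal_of_nat_eq_real_of_nat)
    also have "\<dots> = ennreal ((\<Sum>w\<in>?N. g w) / real (card ?N))"
      using N g fin by (subst sum_ennreal)
        (auto intro!: divide_ennreal sum_nonneg simp: card_gt_0_iff ennreal_of_nat_eq_real_of_nat)
    also have "\<dots> + 1 = ennreal ((\<Sum>w\<in>?N. g w) / real (card ?N) + 1)"
      using N g by (subst ennreal_plus) (auto intro!: sum_nonneg divide_nonneg_nonneg)
    also have "(\<Sum>w\<in>?N. g w) / real (card ?N) + 1 = g v"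
      using eq[OF v] N fin by (simp add: field_simps card_gt_0_iff)
    finally show ?thesis by (simp add: N(1))
  qed

  \<comment> \<open>With \<open>\<tau>\<close> the hitting time of \<open>j\<close>, this says that
    \<open>E[g(\<omega> t); \<tau> > t]\<close> drops by \<open>P(\<tau> > t)\<close> in each step, and \<open>E \<tau>\<close> is the sum of these.\<close>
  have a_Suc: "a t = a (Suc t) + p t" for t
  proof -
    have meas: "alive t \<in> borel_measurable (PiM {0..<Suc t} (\<lambda>_. count_space UNIV))"
    proof -
      have [measurable]: "Measurable.pred (PiM {0..<Suc t} (\<lambda>_. count_space UNIV)) (\<lambda>\<omega>. \<omega> s \<noteq> j)"
        if "s \<in> {..t}" for s
        using that by (intro measurable_compose[OF measurable_component_singleton, of s]) auto
      have "Measurable.pred (PiM {0..<Suc t} (\<lambda>_. count_space UNIV)) (\<lambda>\<omega>. \<forall>s\<in>{..t}. \<omega> s \<noteq> j)"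
        by (rule pred_intros_finite) auto
      then show ?thesis unfolding alive_def[abs_def] by (simp add: Ball_def)
    qed
    \<comment> \<open>Since \<open>g j = 0\<close>, survival at time \<open>Suc t\<close> need not
      be tested. The remaining factor depends only on the history up to \<open>t\<close>, as
      \<open>walk_step\<close> requires.\<close>
    have "alive (Suc t) \<omega> * ennreal (g (\<omega> (Suc t))) = alive t \<omega> * ennreal (g (\<omega> (Suc t)))" for \<omega>
      using g(2) by (cases "\<omega> (Suc t) = j") (auto simp: alive_def le_Suc_eq)
    then have "a (Suc t) = (\<integral>\<^sup>+\<omega>. alive t \<omega> *
        (\<integral>\<^sup>+w. ennreal (g w) \<partial>measure_pmf (pmf_of_set {w. (\<omega> t, w) \<in> parcs G})) \<partial>?W)"
      using walk_step[OF meas, of G i "\<lambda>w. ennreal (g w)"]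
      by (simp add: a_def alive_restrict)
    also have "\<dots> + p t = (\<integral>\<^sup>+\<omega>. alive t \<omega> *
        (\<integral>\<^sup>+w. ennreal (g w) \<partial>measure_pmf (pmf_of_set {w. (\<omega> t, w) \<in> parcs G})) + alive t \<omega> \<partial>?W)"
      unfolding p_def
      by (intro nn_integral_add[symmetric] borel_measurable_times_ennreal alive_measurable
          measurable_compose[OF measurable_walk_coordinate, where g = "\<lambda>v. \<integral>\<^sup>+w. ennreal (g w) \<partial>measure_pmf (pmf_of_set {w. (v, w) \<in> parcs G})"]) simp
    also have "\<dots> = a t"
      unfolding a_def
    proof (rule nn_integral_cong_AE)
      show "AE \<omega> in ?W. alive t \<omega> * (\<integral>\<^sup>+w. ennreal (g w) \<partial>measure_pmf (pmf_of_set {w. (\<omega> t, w) \<in> parcs G}))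
        + alive t \<omega> = alive t \<omega> * ennreal (g (\<omega> t))"
        using ae[of t]
        by eventually_elim (auto simp: alive_def step)
    qed
    finally show ?thesis by simp
  qed

  have "a 0 = ennreal (g i)"
    using walk_start[of G i "\<lambda>v. (if v \<noteq> j then 1 else 0) * ennreal (g v)"] g(2)
    by (auto simp: a_def alive_def)
  then have telescope: "ennreal (g i) = a N + (\<Sum>t<N. p t)" for N
  proof (induction N)
    case (Suc N)
    then show ?case using a_Suc[of N] by (simp add: ac_simps)
  qed simp

  have p_real: "p t = ennreal (enn2real (p t))" for t
  proof -
    have "p t \<le> (\<integral>\<^sup>+\<omega>. 1 \<partial>?W)"
      unfolding p_def by (intro nn_integral_mono) (simp add: alive_def)
    then have "p t < top" unfolding W by (rule order_le_less_trans) simp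
    then show ?thesis by simp
  qed
  \<comment> \<open>The telescoped identity itself bounds the partial sums, so \<open>p\<close>
    tends to 0 without a separate recurrence argument.\<close>
  have "(\<Sum>t<N. enn2real (p t)) \<le> g i" for N
  proof -
    have "ennreal (\<Sum>t<N. enn2real (p t)) = (\<Sum>t<N. p t)"
      by (subst sum_ennreal[symmetric]) (simp_all add: p_real[symmetric])
    also have "\<dots> \<le> ennreal (g i)"
      unfolding telescope[of N] by simp
    finally show ?thesis using g(1)[OF V(4)] by simp
  qed
  then have "summable (\<lambda>t. enn2real (p t))"
    by (intro summableI_nonneg_bounded) auto
  then have "(\<lambda>t. enn2real (p t)) \<longlonglongrightarrow> 0"
    by (rule summable_LIMSEQ_zero)
  then have p0: "p \<longlonglongrightarrow> 0"
    using tendsto_ennrealI[of "\<lambda>t. enn2real (p t)" 0 sequentially] by (simp flip: p_real)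

  \<comment> \<open>Finiteness of \<open>V\<close> bounds \<open>g\<close> along the walk, so the
    remainder \<open>a t\<close> vanishes together with \<open>p t\<close>.\<close>
  define c where "c = Max (g ` V)"
  have "g v \<le> c" if "v \<in> V" for v using that V(1) by (simp add: c_def)
  have a_le: "a t \<le> ennreal c * p t" for t
  proof -
    have "a t \<le> (\<integral>\<^sup>+\<omega>. ennreal c * alive t \<omega> \<partial>?W)"
      unfolding a_def
    proof (rule nn_integral_mono_AE)
      show "AE \<omega> in ?W. alive t \<omega> * ennreal (g (\<omega> t)) \<le> ennreal c * alive t \<omega>"
        using ae[of t]
        by eventually_elim (auto simp: alive_def \<open>\<And>v. v \<in> V \<Longrightarrow> g v \<le> c\<close> intro!: ennreal_leI)
    qed
    also have "\<dots> = ennreal c * p t" unfolding p_def by (rule nn_integral_cmult) simp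
    finally show ?thesis .
  qed
  have "(\<lambda>t. ennreal c * p t) \<longlonglongrightarrow> ennreal c * 0"
    by (intro ennreal_tendsto_cmult p0) simp
  then have lim: "(\<lambda>t. ennreal c * p t + (\<Sum>t. p t)) \<longlonglongrightarrow> 0 + (\<Sum>t. p t)"
    by (intro tendsto_add tendsto_const) simp
  have "(\<Sum>t. p t) = ennreal (g i)"
  proof (rule antisym)
    show "(\<Sum>t. p t) \<le> ennreal (g i)"
    proof (rule suminf_le_const)
      show "(\<Sum>t<N. p t) \<le> ennreal (g i)" for N unfolding telescope[of N] by simp
    qed simp
    have "ennreal (g i) \<le> ennreal c * p N + (\<Sum>t. p t)" for N
      unfolding telescope[of N] by (intro add_mono a_le sum_le_suminf) auto
    with LIMSEQ_le_const[OF lim] show "ennreal (g i) \<le> (\<Sum>t. p t)" by simp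
  qed
  \<comment> \<open>The tail-sum formula for the expectation of a variable with values in
    \<open>enat\<close>.\<close>
  moreover have "expected_hitting_time G i j = (\<Sum>t. p t)"
  proof -
    have "emeasure ?W {\<omega> \<in> space ?W. enat t < hitting_time j \<omega>} = p t" for t
    proof -
      have set: "{\<omega> \<in> space ?W. \<forall>s\<le>t. \<omega> s \<noteq> j} \<in> sets ?W" by measurable
      have "p t = (\<integral>\<^sup>+\<omega>. indicator {\<omega> \<in> space ?W. \<forall>s\<le>t. \<omega> s \<noteq> j} \<omega> \<partial>?W)"
        unfolding p_def by (intro nn_integral_cong) (simp add: alive_def indicator_def)
      then show ?thesis using set unfolding less_hitting_time_iff by (simp del: space_walk_measure)
    qed
    then show ?thesis
      unfolding expected_hitting_time_def
      by (subst nn_integral_enat_function[OF measurable_hitting_time]) simp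
  qed
  ultimately show ?thesis by simp
qed

section \<open>Kemeny's constant of a tree\<close>

text \<open>Tetali's formula for hitting times, with the tree distance as effective
  resistance.\<close>

definition tree_hitting_time :: "'a set \<Rightarrow> 'a rel \<Rightarrow> ('a \<Rightarrow> 'a \<Rightarrow> real) \<Rightarrow> 'a \<Rightarrow> 'a \<Rightarrow> real" where
  "tree_hitting_time V E d i j =
     (\<Sum>k\<in>V. real (card (E `` {k})) * (d i j + d k j - d i k)) / 2"

lemma tree_hitting_time_nonneg:
  assumes T: "tree_metric V E d" and ij: "i \<in> V" "j \<in> V"
  shows "0 \<le> tree_hitting_time V E d i j"
proof -
  have "0 \<le> d i j + d k j - d i k" if "k \<in> V" for k
    using tree_metric_triangle[OF T ij that] tree_metric_sym[OF T that ij(2)] by simp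
  then show ?thesis
    unfolding tree_hitting_time_def by (simp add: sum_nonneg)
qed

lemma tree_hitting_time_refl:
  assumes T: "tree_metric V E d" and j: "j \<in> V"
  shows "tree_hitting_time V E d j j = 0"
proof -
  have "d j j + d k j - d j k = 0" if "k \<in> V" for k
    using tree_metric_refl[OF T j] tree_metric_sym[OF T that j] by simp
  then show ?thesis
    unfolding tree_hitting_time_def by simp
qed

text \<open>By \<open>tree_metric_laplacian\<close> the corrections for the targets \<open>j\<close>
  and \<open>k\<close> cancel unless \<open>k = v\<close>. The surviving term is twice the degree of
  \<open>v\<close>, and the factor 1/2 turns it into the degree itself.\<close>

lemma tree_hitting_time_step:
  assumes T: "tree_metric V E d" and v: "v \<in> V" "j \<in> V" "v \<noteq> j"
  shows "real (card (E `` {v})) * tree_hitting_time V E d v j =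
    real (card (E `` {v})) + (\<Sum>w\<in>E `` {v}. tree_hitting_time V E d w j)"
proof -
  let ?c = "\<lambda>k. real (card (E `` {k}))"
  have fin: "finite V" using T by (rule tree_metric_wf)
  have inner: "(\<Sum>w\<in>E `` {v}. d w j + d k j - d w k) =
      ?c v * (d v j + d k j - d v k) - (if k = v then 2 else 0)" if "k \<in> V" for k
    using tree_metric_laplacian[OF T v(1,2)] tree_metric_laplacian[OF T v(1) that] v(3)
    by (auto simp: sum.distrib sum_subtractf algebra_simps)
  have "(\<Sum>k\<in>V. ?c k * (\<Sum>w\<in>E `` {v}. d w j + d k j - d w k)) =
      (\<Sum>k\<in>V. ?c v * (?c k * (d v j + d k j - d v k)) - (if k = v then 2 * ?c k else 0))"
    by (intro sum.cong refl) (simp only: inner, simp add: algebra_simps)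
  also have "\<dots> = ?c v * (\<Sum>k\<in>V. ?c k * (d v j + d k j - d v k)) - 2 * ?c v"
    using fin v(1) by (simp add: sum_subtractf sum_distrib_left)
  finally have "(\<Sum>w\<in>E `` {v}. \<Sum>k\<in>V. ?c k * (d w j + d k j - d w k)) =
      ?c v * (\<Sum>k\<in>V. ?c k * (d v j + d k j - d v k)) - 2 * ?c v"
    unfolding sum_distrib_left by (subst sum.swap)
  then show ?thesis
    by (simp add: tree_hitting_time_def sum_divide_distrib[symmetric] field_simps)
qed

lemma expected_hitting_time_tree:
  assumes T: "tree_metric (pverts G) (parcs G) d" and n: "2 \<le> card (pverts G)"
    and ij: "i \<in> pverts G" "j \<in> pverts G"
  shows "expected_hitting_time G i j = ennreal (tree_hitting_time (pverts G) (parcs G) d i j)"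
proof (rule expected_hitting_time_eq)
  show "parcs G `` {v} \<noteq> {}" if v: "v \<in> pverts G" for v
  proof
    assume *: "parcs G `` {v} = {}"
    have "pverts G \<noteq> {v}" using n by auto
    then obtain k where "k \<in> pverts G" "k \<noteq> v" using v by blast
    \<comment> \<open>For an isolated \<open>v\<close> the Laplacian identity with target
      \<open>k\<close> would read \<open>0 = - 2\<close>.\<close>
    then show False using tree_metric_laplacian[OF T v, of k] by (simp add: *)
  qed
  show "0 \<le> tree_hitting_time (pverts G) (parcs G) d v j" if v: "v \<in> pverts G" for v
    using tree_hitting_time_nonneg[OF T v ij(2)] .
  show "tree_hitting_time (pverts G) (parcs G) d j j = 0"
    using tree_hitting_time_refl[OF T ij(2)] .
qed (use ij tree_metric_wf[OF T] tree_hitting_time_step[OF T _ ij(2)] in auto)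

lemma vertex_degree_card_nbrs: "vertex_degree G v = card (parcs G `` {v})"
proof -
  have "{e \<in> parcs G. fst e = v} = Pair v ` (parcs G `` {v})" by force
  then show ?thesis
    by (simp add: vertex_degree_def out_degree_def out_arcs_def card_image inj_on_def)
qed

text \<open>Averaging \<open>tree_hitting_time i j\<close> over \<open>j\<close>, the terms \<open>d i j\<close> and \<open>d i k\<close> cancel by symmetry,
  which is why the starting vertex disappears.\<close>

lemma kemeny_tree:
  assumes T: "tree_metric (pverts G) (parcs G) d" and n: "2 \<le> card (pverts G)"
    and i: "i \<in> pverts G"
  shows "kemeny G i = gutman (pverts G) (parcs G) d / (4 * (real (card (pverts G)) - 1))"
proof -
  let ?V = "pverts G" and ?c = "\<lambda>k. real (card (parcs G `` {k}))"
  let ?h = "tree_hitting_time ?V (parcs G) d"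
  have m: "real (card (edge_set G)) = real (card ?V) - 1"
    using tree_metric_card_edges[OF T] n by (simp add: edge_set_def)
  have "2 * (?c j * ?h i j) =
      (\<Sum>k\<in>?V. ?c j * ?c k * d i j) + (\<Sum>k\<in>?V. ?c j * ?c k * d k j) - (\<Sum>k\<in>?V. ?c j * ?c k * d i k)"
    for j
  proof -
    have "2 * (?c j * ?h i j) = ?c j * (\<Sum>k\<in>?V. ?c k * (d i j + d k j - d i k))"
      by (simp add: tree_hitting_time_def)
    then show ?thesis
      by (simp add: sum_distrib_left sum.distrib sum_subtractf algebra_simps)
  qed
  then have "2 * (\<Sum>j\<in>?V. ?c j * ?h i j) =
      (\<Sum>j\<in>?V. \<Sum>k\<in>?V. ?c j * ?c k * d i j) + (\<Sum>j\<in>?V. \<Sum>k\<in>?V. ?c j * ?c k * d k j)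
      - (\<Sum>j\<in>?V. \<Sum>k\<in>?V. ?c j * ?c k * d i k)"
    by (simp add: sum_distrib_left sum.distrib sum_subtractf)
  also have "(\<Sum>j\<in>?V. \<Sum>k\<in>?V. ?c j * ?c k * d i k) = (\<Sum>j\<in>?V. \<Sum>k\<in>?V. ?c j * ?c k * d i j)"
    by (subst sum.swap) (simp add: mult.commute)
  also have "(\<Sum>j\<in>?V. \<Sum>k\<in>?V. ?c j * ?c k * d k j) = gutman ?V (parcs G) d"
    unfolding gutman_def weighted_distance_def sum_distrib_left
    by (intro sum.cong refl) (simp add: tree_metric_sym[OF T] mult.assoc)
  finally have "(\<Sum>j\<in>?V. ?c j * ?h i j) = gutman ?V (parcs G) d / 2" by simp
  \<comment> \<open>Nonnegativity of the hitting times is what lets \<open>enn2real\<close> undo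
    \<open>ennreal\<close>.\<close>
  moreover have "kemeny G i = (\<Sum>j\<in>?V. ?c j * ?h i j) / (2 * (real (card ?V) - 1))"
    unfolding kemeny_def sum_divide_distrib
    by (intro sum.cong refl)
      (simp add: stationary_def vertex_degree_card_nbrs m expected_hitting_time_tree[OF T n i]
        tree_hitting_time_nonneg[OF T i])
  ultimately have "kemeny G i = gutman ?V (parcs G) d / 2 / (2 * (real (card ?V) - 1))"
    by (simp only:)
  then show ?thesis by simp
qed

theorem theorem3p8:
  fixes T :: "'a pair_pre_digraph" and n :: nat and i :: 'a and k :: nat
  assumes "2 \<le> n"
    and "undirected_tree T"
    and "card (pverts T) = n"
    and "i \<in> pverts T"
    and "k \<in> pverts (path_graph n)"
  shows "kemeny T i \<le> kemeny (path_graph n) k"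
proof -
  obtain d where d: "tree_metric (pverts T) (parcs T) d"
    using undirected_tree_tree_metric[OF assms(2)] by blast
  obtain d' where d': "tree_metric (pverts (path_graph n)) (parcs (path_graph n)) d'"
    "gutman (pverts (path_graph n)) (parcs (path_graph n)) d' = path_gutman n"
    using path_graph_tree_metric[of "n - 1"] assms(1) by auto
  have card: "card (pverts (path_graph n)) = n" by (simp add: path_graph_def)
  have "kemeny T i = gutman (pverts T) (parcs T) d / (4 * (real n - 1))"
    using kemeny_tree[OF d _ assms(4)] assms(1,3) by simp
  also have "\<dots> \<le> path_gutman n / (4 * (real n - 1))"
    using gutman_le[OF d] assms(1,3) by (intro divide_right_mono) auto
  also have "\<dots> = kemeny (path_graph n) k"
    using kemeny_tree[OF d'(1) _ assms(5)] assms(1) card d'(2) by simp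
  finally show ?thesis .
qed

end
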